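(* Let $N\ge 2$ be an integer and let $A$ be an $N\times N$ complex unitary matrix all of whose first-row entries equal $1/\sqrt N$. Let $(W_{n,A})_{n\ge 0}$ be the generalized Walsh functions associated to $A$. For $f\in L^1[0,1]$ and $q\ge 1$ put $$S_{N^q}(f)=\sum_{n=0}^{N^q-1}\langle f, W_{n,A}\rangle W_{n,A},$$ and let $\mathcal F_q$ be the $\sigma$-algebra on $[0,1)$ generated by the intervals $[j/N^q,(j+1)/N^q)$, $j=0,\dots,N^q-1$. Then for every $f\in L^1[0,1]$ the sequence $(S_{N^q}(f))_{q\ge1}$ is a martingale with respect to $(\mathcal F_q)_{q\ge 1}$; that is, for all integers $q\ge1$, $$\mathbb E[f\mid\mathcal F_q]=S_{N^q}(f)\qquad\text{and}\qquad \mathbb E[S_{N^{q+1}}(f)\mid\mathcal F_q]=S_{N^q}(f).$$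
   Context: Conditional expectations are taken with respect to Lebesgue measure on $[0,1)$ with its Borel $\sigma$-algebra; equalities are almost everywhere. Generalized Walsh functions. Write $A=[a_{ij}]_{0\le i,j\le N-1}$, a complex unitary $N\times N$ matrix with $a_{0j}=1/\sqrt N$ for all $j$. For $0\le i\le N-1$ let $m_i(x)=\sqrt N\sum_{j=0}^{N-1}a_{ij}\chi_{[j/N,(j+1)/N)}(x)$ for $x\in[0,1)$, so $m_0\equiv 1$. Let $r(x)=(Nx)\bmod 1$, i.e. $r(x)=Nx-l$ for $x\in[l/N,(l+1)/N)$, $l\in\{0,\dots,N-1\}$. At the endpoint $x=1$ the convention is $r(1)=1$ and $m_i(1)=\sqrt N a_{i,N-1}$. For an integer $n\ge 0$ with base-$N$ expansion $n=\sum_{k=0}^{p-1}i_kN^k$, $i_k\in\{0,\dots,N-1\}$, set $$W_{n,A}(x)=m_{i_0}(x)\,m_{i_1}(r x)\cdots m_{i_{p-1}}(r^{p-1}x),$$ where $r^k$ is the $k$-fold iterate of $r$; $W_{0,A}\equiv1$. Functions are complex valued and $\langle f,g\rangle=\int_0^1 f(t)\overline{g(t)}\,dt$. *)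

theory Defs
  imports "HOL-Probability.Probability" "Jordan_Normal_Form.Schur_Decomposition"
begin

definition unitary_mat :: "complex mat \<Rightarrow> bool" where
  "unitary_mat U \<longleftrightarrow>
     square_mat U \<and> U * mat_adjoint U = 1\<^sub>m (dim_row U) \<and> mat_adjoint U * U = 1\<^sub>m (dim_row U)"

section \<open>Generalized Walsh functions\<close>

text \<open>Functions on the unit interval are total functions on the reals; only their values on
  \<open>{0..1}\<close> matter. The filters \<open>m\<^sub>i\<close> and the map \<open>r\<close> carry an explicit convention at the endpoint
  \<open>x = 1\<close>.\<close>

definition walsh_filter :: "nat \<Rightarrow> complex mat \<Rightarrow> nat \<Rightarrow> real \<Rightarrow> complex" where
  "walsh_filter N A i x =
     (if x = 1 then complex_of_real (sqrt (real N)) * A $$ (i, N - 1)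
      else complex_of_real (sqrt (real N)) *
        (\<Sum>j<N. A $$ (i, j) * indicator {real j / real N ..< (real j + 1) / real N} x))"

definition walsh_shift :: "nat \<Rightarrow> real \<Rightarrow> real" where
  "walsh_shift N x = (if x = 1 then 1 else frac (real N * x))"

text \<open>The number of base-\<open>N\<close> digits of \<open>n\<close> (for \<open>N \<ge> 2\<close>), which is \<open>0\<close> for \<open>n = 0\<close>. A longer
  expansion, padded with zeros, would give the same Walsh function on \<open>{0..1}\<close> because
  \<open>m\<^sub>0 = 1\<close> there.\<close>

definition num_digits :: "nat \<Rightarrow> nat \<Rightarrow> nat" where
  "num_digits N n = (LEAST p. n < N ^ p)"

definition digit :: "nat \<Rightarrow> nat \<Rightarrow> nat \<Rightarrow> nat" where
  "digit N n k = (n div N ^ k) mod N"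

definition walsh :: "nat \<Rightarrow> complex mat \<Rightarrow> nat \<Rightarrow> real \<Rightarrow> complex" where
  "walsh N A n x =
     (\<Prod>k<num_digits N n. walsh_filter N A (digit N n k) ((walsh_shift N ^^ k) x))"

definition unit_inner :: "(real \<Rightarrow> complex) \<Rightarrow> (real \<Rightarrow> complex) \<Rightarrow> complex" where
  "unit_inner f g = (LINT t:{0..1}|lborel. f t * cnj (g t))"

definition walsh_sum :: "nat \<Rightarrow> complex mat \<Rightarrow> (real \<Rightarrow> complex) \<Rightarrow> nat \<Rightarrow> real \<Rightarrow> complex" where
  "walsh_sum N A f K x = (\<Sum>n<K. unit_inner f (walsh N A n) * walsh N A n x)"

section \<open>The filtration, conditional expectations and martingales\<close>

definition unit_space :: "real measure" where
  "unit_space = restrict_space lborel {0..<1}"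

definition nadic_algebra :: "nat \<Rightarrow> nat \<Rightarrow> real measure" where
  "nadic_algebra N q =
     sigma {0..<1} {{real j / real (N ^ q) ..< (real j + 1) / real (N ^ q)} | j. j < N ^ q}"

text \<open>The library provides conditional expectations of real-valued functions; for complex-valued
  ones they are taken componentwise.\<close>

definition complex_cond_exp ::
  "'a measure \<Rightarrow> 'a measure \<Rightarrow> ('a \<Rightarrow> complex) \<Rightarrow> 'a \<Rightarrow> complex" where
  "complex_cond_exp M F f x =
     Complex (real_cond_exp M F (\<lambda>y. Re (f y)) x) (real_cond_exp M F (\<lambda>y. Im (f y)) x)"

text \<open>The defining properties of the conditional expectation hold for this version.\<close>

lemma borel_measurable_complex_cond_exp:
  "complex_cond_exp M F f \<in> borel_measurable F"
  unfolding complex_cond_exp_def[abs_def] borel_measurable_complex_iff by simp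

lemma (in sigma_finite_subalgebra) complex_cond_exp_int:
  assumes f: "integrable M f"
  shows "integrable M (complex_cond_exp M F f)"
    and "A \<in> sets F \<Longrightarrow> (LINT x:A|M. complex_cond_exp M F f x) = (LINT x:A|M. f x)"
proof -
  have Re: "integrable M (\<lambda>x. Re (f x))" and Im: "integrable M (\<lambda>x. Im (f x))"
    using f by auto
  show int: "integrable M (complex_cond_exp M F f)"
    unfolding complex_cond_exp_def[abs_def] Complex_eq
    using real_cond_exp_int(1)[OF Re] real_cond_exp_int(1)[OF Im]
    by (intro Bochner_Integration.integrable_add integrable_mult_right integrable_of_real) auto
  assume A: "A \<in> sets F"
  then have AM: "A \<in> sets M"
    using subalg by (auto simp: subalgebra_def)
  have i1: "integrable M (\<lambda>x. indicat_real A x *\<^sub>R complex_cond_exp M F f x)"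
    and i2: "integrable M (\<lambda>x. indicat_real A x *\<^sub>R f x)"
    using AM int f by (auto intro: integrable_mult_indicator)
  have "Re (LINT x:A|M. complex_cond_exp M F f x) = Re (LINT x:A|M. f x)"
    using real_cond_exp_intA[OF Re A] integral_Re[OF i1] integral_Re[OF i2]
    unfolding set_lebesgue_integral_def by (simp add: complex_cond_exp_def)
  moreover have "Im (LINT x:A|M. complex_cond_exp M F f x) = Im (LINT x:A|M. f x)"
    using real_cond_exp_intA[OF Im A] integral_Im[OF i1] integral_Im[OF i2]
    unfolding set_lebesgue_integral_def by (simp add: complex_cond_exp_def)
  ultimately show "(LINT x:A|M. complex_cond_exp M F f x) = (LINT x:A|M. f x)"
    by (simp add: complex_eq_iff)
qed

definition complex_martingale_on ::
  "nat set \<Rightarrow> 'a measure \<Rightarrow> (nat \<Rightarrow> 'a measure) \<Rightarrow> (nat \<Rightarrow> 'a \<Rightarrow> complex) \<Rightarrow> bool" where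
  "complex_martingale_on I M F X \<longleftrightarrow>
     (\<forall>i\<in>I. subalgebra M (F i)) \<and>
     (\<forall>i\<in>I. \<forall>j\<in>I. i \<le> j \<longrightarrow> subalgebra (F j) (F i)) \<and>
     (\<forall>i\<in>I. X i \<in> borel_measurable (F i) \<and> integrable M (X i)) \<and>
     (\<forall>i\<in>I. \<forall>j\<in>I. i \<le> j \<longrightarrow> (AE x in M. complex_cond_exp M (F i) (X j) x = X i x))"

end

theory Submission
  imports Defs
begin

text \<open>
  The partial sum \<open>S f\<close> of order \<open>N ^ q\<close> is the integral of \<open>f\<close> against the kernel
  \<open>K\<^sub>q(x, t) = (\<Sum>n<N ^ q. W\<^sub>n(x) * cnj (W\<^sub>n(t)))\<close>, and everything rests on the fact
  (\<open>walsh_kernel\<close>) that on \<open>{0..<1}\<close> this kernel equals \<open>N ^ q\<close> when \<open>x\<close> and \<open>t\<close> lie in the same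
  \<open>N\<close>-adic interval of length \<open>1 / N ^ q\<close> and vanishes otherwise. The reason is a product
  structure: prepending a lowest digit \<open>i\<close> to \<open>n\<close> multiplies \<open>W\<^sub>n(r x)\<close> by \<open>m\<^sub>i(x)\<close>,
  hence \<open>K\<^sub>q\<^sub>+\<^sub>1(x, t) = K\<^sub>1(x, t) * K\<^sub>q(r x, r t)\<close>. The factor \<open>K\<^sub>1\<close> tests whether
  the first \<open>N\<close>-adic digits of \<open>x\<close> and \<open>t\<close> agree, because the columns of a unitary matrix
  are orthonormal, and \<open>r\<close> drops that digit.

  Consequently \<open>S f\<close> is, on each cell, the average of \<open>f\<close> over that cell
  (\<open>walsh_sum_eq_cell_average\<close>). Every set of the \<open>\<sigma>\<close>-algebra generated by the cells is a
  finite union of cells (\<open>sets_nadic_algebra_iff\<close>), so \<open>S f\<close> is measurable for it and has the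
  same integral as \<open>f\<close> over each of its sets: it is the conditional expectation of \<open>f\<close>.
  The martingale property is then the tower property of conditional expectations.
\<close>

section \<open>N-adic cells\<close>

text \<open>On \<open>{0..<1}\<close> this is the integer whose \<open>q\<close> base-\<open>N\<close> digits are the first \<open>q\<close> digits of
  the expansion of \<open>x\<close>; being in the same cell becomes equality of indices.\<close>

definition nadic_index :: "nat \<Rightarrow> nat \<Rightarrow> real \<Rightarrow> int" where
  "nadic_index N q x = \<lfloor>real (N ^ q) * x\<rfloor>"

definition nadic_cell :: "nat \<Rightarrow> nat \<Rightarrow> nat \<Rightarrow> real set" where
  "nadic_cell N q j = {real j / real (N ^ q) ..< (real j + 1) / real (N ^ q)}"

lemma mem_nadic_cell_iff:
  assumes "N > 0"
  shows "x \<in> nadic_cell N q j \<longleftrightarrow> nadic_index N q x = int j"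
proof -
  have "real (N ^ q) > 0" using assms by simp
  then show ?thesis
    unfolding nadic_cell_def nadic_index_def floor_eq_iff
    by (auto simp: divide_le_eq less_divide_eq mult.commute)
qed

lemma nadic_index_bounds:
  assumes "N > 0" "x \<in> {0..<1}"
  shows "0 \<le> nadic_index N q x" "nadic_index N q x < int (N ^ q)"
proof -
  have "real (N ^ q) > 0" using assms by simp
  then have "real (N ^ q) * x < real (N ^ q) * 1"
    using assms(2) by (intro mult_strict_left_mono) auto
  then show "nadic_index N q x < int (N ^ q)"
    unfolding nadic_index_def floor_less_iff by simp
  show "0 \<le> nadic_index N q x"
    unfolding nadic_index_def using assms by simp
qed

text \<open>A coarser index forgets the last \<open>q - p\<close> digits of a finer one; this is why the cells of a
  finer level subdivide those of a coarser level.\<close>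

lemma nadic_index_eq_div:
  assumes "N > 0" "p \<le> q"
  shows "nadic_index N p x = nadic_index N q x div int (N ^ (q - p))"
proof -
  have nonzero: "real (N ^ (q - p)) \<noteq> 0" using assms by simp
  have "real (N ^ q) = real (N ^ p) * real (N ^ (q - p))"
    using assms(2) by (simp flip: power_add)
  then have "real (N ^ q) * x = real (N ^ p) * x * real (N ^ (q - p))"
    by (simp only: mult_ac)
  then have "real (N ^ p) * x = real (N ^ q) * x / real_of_int (int (N ^ (q - p)))"
    by (simp only: of_int_of_nat_eq nonzero_mult_div_cancel_right[OF nonzero])
  then show ?thesis
    unfolding nadic_index_def by (simp only: floor_divide_real_eq_div)
qed

text \<open>Comparing the first \<open>q + 1\<close> digits means comparing the first digit and then the first \<open>q\<close>
  digits after the shift. This drives the induction that computes the Walsh kernel.\<close>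

lemma nadic_index_Suc_eq_iff:
  assumes "N > 0"
  shows "nadic_index N (Suc q) x = nadic_index N (Suc q) t \<longleftrightarrow>
    nadic_index N 1 x = nadic_index N 1 t \<and>
    nadic_index N q (frac (real N * x)) = nadic_index N q (frac (real N * t))"
proof -
  \<comment> \<open>The shift removes the leading digit from the index.\<close>
  have shift: "nadic_index N q (frac (real N * y)) =
      nadic_index N (Suc q) y - int (N ^ q) * nadic_index N 1 y" for y
  proof -
    have "real (N ^ q) * frac (real N * y) =
        real (N ^ Suc q) * y - of_int (int (N ^ q) * \<lfloor>real N * y\<rfloor>)"
      by (simp add: frac_def algebra_simps)
    then show ?thesis
      unfolding nadic_index_def by (simp only: floor_diff_of_int) simp
  qed
  have "nadic_index N 1 y = nadic_index N (Suc q) y div int (N ^ q)" for y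
    using nadic_index_eq_div[OF assms, of 1 "Suc q" y] by simp
  with shift show ?thesis by auto
qed

lemma nadic_cell_subset:
  assumes "N > 0" "j < N ^ q"
  shows "nadic_cell N q j \<subseteq> {0..<1}"
proof -
  have "real (N ^ q) > 0" using assms by simp
  moreover have "real j + 1 \<le> real (N ^ q)" using assms(2) by linarith
  ultimately have "0 \<le> real j / real (N ^ q)" "(real j + 1) / real (N ^ q) \<le> 1"
    by (simp_all only: divide_le_eq_1_pos) simp
  then show ?thesis unfolding nadic_cell_def by auto
qed

lemma UN_nadic_cells:
  assumes "N > 0"
  shows "(\<Union>j<N ^ q. nadic_cell N q j) = {0..<1}"
proof
  show "(\<Union>j<N ^ q. nadic_cell N q j) \<subseteq> {0..<1}"
    using nadic_cell_subset[OF assms] by blast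
  show "{0..<1} \<subseteq> (\<Union>j<N ^ q. nadic_cell N q j)"
  proof
    fix x :: real assume x: "x \<in> {0..<1}"
    obtain j where j: "nadic_index N q x = int j"
      using nadic_index_bounds(1)[OF assms x] nonneg_int_cases by blast
    have "j < N ^ q"
      using nadic_index_bounds(2)[OF assms x, of q] unfolding j by (simp only: of_nat_less_iff)
    moreover have "x \<in> nadic_cell N q j"
      unfolding mem_nadic_cell_iff[OF assms] by (rule j)
    ultimately show "x \<in> (\<Union>j<N ^ q. nadic_cell N q j)" by blast
  qed
qed

lemma space_nadic_algebra [simp]: "space (nadic_algebra N q) = {0..<1}"
  unfolding nadic_algebra_def by (rule space_measure_of_conv)

lemma sets_nadic_algebra:
  assumes "N > 0"
  shows "sets (nadic_algebra N q) = sigma_sets {0..<1} (nadic_cell N q ` {..<N ^ q})"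
proof -
  have *: "{{real j / real (N ^ q) ..< (real j + 1) / real (N ^ q)} | j. j < N ^ q}
      = nadic_cell N q ` {..<N ^ q}"
    by (auto simp: nadic_cell_def)
  have "nadic_cell N q ` {..<N ^ q} \<subseteq> Pow {0..<1}"
    using nadic_cell_subset[OF assms] by blast
  then show ?thesis unfolding nadic_algebra_def * by (rule sets_measure_of)
qed

text \<open>Unions of cells are the sets that do not separate points with the same index, and this
  invariance is preserved by complements and countable unions. The description reduces integrals
  over arbitrary sets of the algebra to integrals over single cells.\<close>

lemma sets_nadic_algebra_iff:
  assumes "N > 0"
  shows "S \<in> sets (nadic_algebra N q) \<longleftrightarrow>
    (\<exists>J\<subseteq>{..<N ^ q}. S = (\<Union>j\<in>J. nadic_cell N q j))" (is "?L \<longleftrightarrow> ?R")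
proof
  assume ?R
  then obtain J where J: "J \<subseteq> {..<N ^ q}" "S = (\<Union>j\<in>J. nadic_cell N q j)" by blast
  have "finite J" using J(1) by (rule finite_subset) simp
  then show ?L unfolding J(2) using J(1)
    by (intro sets.finite_UN) (auto simp: sets_nadic_algebra[OF assms] intro!: sigma_sets.Basic)
next
  have ex: "\<exists>J\<subseteq>{..<N ^ q}. S = (\<Union>j\<in>J. nadic_cell N q j)"
    if S: "S \<subseteq> {0..<1}" and sat: "\<And>x y. x \<in> S \<Longrightarrow> y \<in> {0..<1} \<Longrightarrow>
      nadic_index N q x = nadic_index N q y \<Longrightarrow> y \<in> S" for S
  proof (intro exI conjI)
    let ?J = "{j. j < N ^ q \<and> nadic_cell N q j \<inter> S \<noteq> {}}"
    show "?J \<subseteq> {..<N ^ q}" by auto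
    show "S = (\<Union>j\<in>?J. nadic_cell N q j)"
    proof
      show "S \<subseteq> (\<Union>j\<in>?J. nadic_cell N q j)"
      proof
        fix x assume x: "x \<in> S"
        then obtain j where "j < N ^ q" "x \<in> nadic_cell N q j"
          using S unfolding UN_nadic_cells[OF assms, of q, symmetric] by blast
        with x show "x \<in> (\<Union>j\<in>?J. nadic_cell N q j)" by blast
      qed
      show "(\<Union>j\<in>?J. nadic_cell N q j) \<subseteq> S"
      proof
        fix y assume "y \<in> (\<Union>j\<in>?J. nadic_cell N q j)"
        then obtain j x where "j < N ^ q" "x \<in> S" "x \<in> nadic_cell N q j" "y \<in> nadic_cell N q j"
          by blast
        moreover from this have "y \<in> {0..<1}" using nadic_cell_subset[OF assms] by blast
        ultimately show "y \<in> S"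
          using sat[of x y] by (simp add: mem_nadic_cell_iff[OF assms])
      qed
    qed
  qed
  assume ?L
  then have "S \<in> sigma_sets {0..<1} (nadic_cell N q ` {..<N ^ q})"
    unfolding sets_nadic_algebra[OF assms] .
  then have "S \<subseteq> {0..<1} \<and> (\<forall>x\<in>S. \<forall>y\<in>{0..<1}.
      nadic_index N q x = nadic_index N q y \<longrightarrow> y \<in> S)"
  proof induction
    case (Basic a)
    then show ?case
      using nadic_cell_subset[OF assms] by (auto simp: mem_nadic_cell_iff[OF assms])
  next
    case Empty
    then show ?case by simp
  next
    case (Compl a)
    then show ?case by (metis DiffD1 DiffD2 DiffI Diff_subset)
  next
    case (Union a)
    then show ?case by blast
  qed
  then show ?R by (elim conjE) (rule ex, assumption, metis)
qed

lemma measurable_nadic_algebraI: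
  assumes "N > 0"
  shows "(\<lambda>x. g (nadic_index N q x)) \<in> measurable (nadic_algebra N q) borel"
proof (rule measurableI)
  fix B
  have "(\<lambda>x. g (nadic_index N q x)) -` B \<inter> {0..<1} =
      (\<Union>j\<in>{j. j < N ^ q \<and> g (int j) \<in> B}. nadic_cell N q j)"
    (is "?V = ?U")
  proof (intro equalityI subsetI)
    fix x assume x: "x \<in> ?V"
    then have "x \<in> {0..<1}" by blast
    then obtain j where j: "j < N ^ q" "x \<in> nadic_cell N q j"
      unfolding UN_nadic_cells[OF assms, of q, symmetric] by blast
    then show "x \<in> ?U" using x mem_nadic_cell_iff[OF assms, of x q j] by auto
  next
    fix x assume "x \<in> ?U"
    moreover from this have "x \<in> {0..<1}" using nadic_cell_subset[OF assms] by blast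
    ultimately show "x \<in> ?V" by (auto simp: mem_nadic_cell_iff[OF assms])
  qed
  moreover have "?U \<in> sets (nadic_algebra N q)"
    unfolding sets_nadic_algebra_iff[OF assms] by (rule exI, rule conjI[OF _ refl]) auto
  ultimately show "(\<lambda>x. g (nadic_index N q x)) -` B \<inter> space (nadic_algebra N q)
      \<in> sets (nadic_algebra N q)" by simp
qed auto

section \<open>The filtration\<close>

lemma space_unit_space [simp]: "space unit_space = {0..<1}"
  by (simp add: unit_space_def space_restrict_space)

lemma finite_measure_unit_space: "finite_measure unit_space"
  by (rule finite_measureI) (simp add: unit_space_def space_restrict_space emeasure_restrict_space)

lemma sets_unit_space: "S \<in> sets unit_space \<longleftrightarrow> S \<in> sets borel \<and> S \<subseteq> {0..<1}"
  by (auto simp: unit_space_def sets_restrict_space_iff)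

lemma subalgebra_unit_space:
  assumes "N > 0"
  shows "subalgebra unit_space (nadic_algebra N q)"
proof -
  have "S \<in> sets unit_space" if S: "S \<in> sets (nadic_algebra N q)" for S
  proof -
    obtain J where J: "J \<subseteq> {..<N ^ q}" "S = (\<Union>j\<in>J. nadic_cell N q j)"
      using S unfolding sets_nadic_algebra_iff[OF assms] by blast
    have "finite J" using J(1) by (rule finite_subset) simp
    then have "S \<in> sets borel" unfolding J(2) by (intro sets.finite_UN) (auto simp: nadic_cell_def)
    then show ?thesis using sets.sets_into_space[OF S] by (simp add: sets_unit_space)
  qed
  then show ?thesis by (auto simp: subalgebra_def)
qed

lemma subalgebra_nadic_algebra_mono:
  assumes "N > 0" "p \<le> q"
  shows "subalgebra (nadic_algebra N q) (nadic_algebra N p)"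
proof -
  have "nadic_cell N p j \<in> sets (nadic_algebra N q)" if j: "j < N ^ p" for j
  proof -
    let ?g = "\<lambda>i. of_bool (i div int (N ^ (q - p)) = int j) :: real"
    have "(\<lambda>x. ?g (nadic_index N q x)) -` {1} \<inter> space (nadic_algebra N q)
        \<in> sets (nadic_algebra N q)"
      by (rule measurable_sets[OF measurable_nadic_algebraI[OF assms(1)]]) simp
    also have "(\<lambda>x. ?g (nadic_index N q x)) -` {1} \<inter> space (nadic_algebra N q) =
        nadic_cell N p j"
      using nadic_cell_subset[OF assms(1) j]
      by (auto simp: mem_nadic_cell_iff[OF assms(1)] nadic_index_eq_div[OF assms])
    finally show ?thesis .
  qed
  then have "sigma_sets (space (nadic_algebra N q)) (nadic_cell N p ` {..<N ^ p})
      \<subseteq> sets (nadic_algebra N q)"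
    by (intro sets.sigma_sets_subset) auto
  then show ?thesis
    by (simp add: subalgebra_def sets_nadic_algebra[OF assms(1), of p])
qed

lemma sigma_finite_subalgebra_nadic:
  assumes "N > 0"
  shows "sigma_finite_subalgebra unit_space (nadic_algebra N q)"
  by (intro finite_measure_subalgebra_is_sigma_finite finite_measure_subalgebra.intro
      finite_measure_subalgebra_axioms.intro finite_measure_unit_space
      subalgebra_unit_space[OF assms])

section \<open>Conditional expectations of complex functions\<close>

text \<open>Real and imaginary parts commute with the integral, so uniqueness of the conditional
  expectation passes from real functions to complex ones.\<close>

lemma (in sigma_finite_subalgebra) complex_cond_exp_charact:
  assumes "\<And>S. S \<in> sets F \<Longrightarrow> (LINT x:S|M. f x) = (LINT x:S|M. g x)"
    and f: "integrable M f" and g: "integrable M g" and gF: "g \<in> borel_measurable F"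
  shows "AE x in M. complex_cond_exp M F f x = g x"
proof -
  have int: "integrable M (\<lambda>x. indicat_real S x *\<^sub>R h x)"
    if "S \<in> sets F" "integrable M h" for S and h :: "'a \<Rightarrow> complex"
    using that subalg by (intro integrable_mult_indicator) (auto simp: subalgebra_def)
  have "AE x in M. real_cond_exp M F (\<lambda>y. Re (f y)) x = Re (g x)"
  proof (rule real_cond_exp_charact)
    fix S assume S: "S \<in> sets F"
    show "(LINT x:S|M. Re (f x)) = (LINT x:S|M. Re (g x))"
      using arg_cong[OF assms(1)[OF S], of Re]
        integral_Re[OF int[OF S f]] integral_Re[OF int[OF S g]]
      by (simp add: set_lebesgue_integral_def)
  qed (use f g gF in auto)
  moreover have "AE x in M. real_cond_exp M F (\<lambda>y. Im (f y)) x = Im (g x)"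
  proof (rule real_cond_exp_charact)
    fix S assume S: "S \<in> sets F"
    show "(LINT x:S|M. Im (f x)) = (LINT x:S|M. Im (g x))"
      using arg_cong[OF assms(1)[OF S], of Im]
        integral_Im[OF int[OF S f]] integral_Im[OF int[OF S g]]
      by (simp add: set_lebesgue_integral_def)
  qed (use f g gF in auto)
  ultimately show ?thesis
    by eventually_elim (simp add: complex_cond_exp_def)
qed

text \<open>The tower property, for an arbitrary version \<open>h\<close> of the inner conditional expectation: the
  Walsh partial sums agree with the canonical version only almost everywhere. Every set of \<open>F\<close> is
  a set of \<open>G\<close>, so \<open>h\<close> and \<open>f\<close> have the same integral over it.\<close>

lemma (in sigma_finite_subalgebra) complex_cond_exp_of_cond_exp:
  assumes "subalgebra M G" "subalgebra G F" and f: "integrable M f" and h: "integrable M h"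
    and hG: "AE x in M. complex_cond_exp M G f x = h x"
  shows "AE x in M. complex_cond_exp M F h x = complex_cond_exp M F f x"
proof -
  interpret G: sigma_finite_subalgebra M G
    by (rule nested_subalg_is_sigma_finite[OF assms(1,2)])
  have FG: "sets F \<subseteq> sets G" and GM: "sets G \<subseteq> sets M"
    using assms(1,2) by (auto simp: subalgebra_def)
  show ?thesis
  proof (rule complex_cond_exp_charact[OF _ h complex_cond_exp_int(1)[OF f]
        borel_measurable_complex_cond_exp])
    fix S assume S: "S \<in> sets F"
    have "(LINT x:S|M. h x) = (LINT x:S|M. complex_cond_exp M G f x)"
      unfolding set_lebesgue_integral_def
    proof (rule integral_cong_AE)
      have "S \<in> sets M" using S FG GM by blast
      then show "(\<lambda>x. indicat_real S x *\<^sub>R h x) \<in> borel_measurable M"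
        "(\<lambda>x. indicat_real S x *\<^sub>R complex_cond_exp M G f x) \<in> borel_measurable M"
        using h G.complex_cond_exp_int(1)[OF f]
        by (auto intro: borel_measurable_integrable integrable_mult_indicator)
      show "AE x in M. indicat_real S x *\<^sub>R h x = indicat_real S x *\<^sub>R complex_cond_exp M G f x"
        using hG by eventually_elim simp
    qed
    also have "\<dots> = (LINT x:S|M. f x)"
      using S FG by (intro G.complex_cond_exp_int(2)[OF f]) auto
    also have "\<dots> = (LINT x:S|M. complex_cond_exp M F f x)"
      by (rule complex_cond_exp_int(2)[OF f S, symmetric])
    finally show "(LINT x:S|M. h x) = (LINT x:S|M. complex_cond_exp M F f x)" .
  qed
qed

section \<open>The kernel of the Walsh partial sums\<close>

lemma unitary_mat_columns_orthonormal:
  assumes "A \<in> carrier_mat N N" "unitary_mat A" "j < N" "k < N"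
  shows "(\<Sum>i<N. A $$ (i, j) * cnj (A $$ (i, k))) = of_bool (j = k)"
proof -
  have "mat_adjoint A * A = 1\<^sub>m N" using assms unfolding unitary_mat_def by auto
  then have "(mat_adjoint A * A) $$ (k, j) = (1\<^sub>m N :: complex mat) $$ (k, j)" by simp
  moreover have "(mat_adjoint A * A) $$ (k, j) = (\<Sum>i<N. A $$ (i, j) * cnj (A $$ (i, k)))"
    using assms by (simp add: mat_adjoint_def scalar_prod_def mat_of_rows_index lessThan_atLeast0 mult.commute)
  ultimately show ?thesis using assms by auto
qed

lemma walsh_filter_eq:
  assumes "N > 0" "x \<in> {0..<1}"
  shows "walsh_filter N A i x =
    complex_of_real (sqrt (real N)) * A $$ (i, nat (nadic_index N 1 x))"
proof -
  have "(\<Sum>j<N. A $$ (i, j) * indicator {real j / real N ..< (real j + 1) / real N} x) =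
      (\<Sum>j<N. if j = nat (nadic_index N 1 x) then A $$ (i, j) else 0)"
  proof (rule sum.cong)
    fix j
    show "A $$ (i, j) * indicator {real j / real N ..< (real j + 1) / real N} x =
        (if j = nat (nadic_index N 1 x) then A $$ (i, j) else 0)"
      using mem_nadic_cell_iff[OF assms(1), of x 1 j] nadic_index_bounds(1)[OF assms, of 1]
      by (auto simp: nadic_cell_def indicator_def)
  qed simp
  also have "\<dots> = A $$ (i, nat (nadic_index N 1 x))"
    using nadic_index_bounds[OF assms, of 1] by simp
  finally show ?thesis using assms(2) by (simp add: walsh_filter_def)
qed

locale walsh_matrix =
  fixes N :: nat and A :: "complex mat"
  assumes N_ge_2: "N \<ge> 2"
    and A_carrier: "A \<in> carrier_mat N N"
    and A_unitary: "unitary_mat A"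
    and first_row: "\<And>j. j < N \<Longrightarrow> A $$ (0, j) = 1 / complex_of_real (sqrt (real N))"

lemma (in walsh_matrix) N_pos: "N > 0"
  using N_ge_2 by simp

text \<open>The kernel at level one: on the cell with index \<open>j\<close> the filters take the values
  \<open>sqrt N * A $$ (i, j)\<close>, so the sum is \<open>N\<close> times an inner product of two columns of \<open>A\<close>.\<close>

lemma (in walsh_matrix) sum_walsh_filter_kernel:
  assumes "x \<in> {0..<1}" "t \<in> {0..<1}"
  shows "(\<Sum>i<N. walsh_filter N A i x * cnj (walsh_filter N A i t)) =
    (if nadic_index N 1 x = nadic_index N 1 t then of_nat N else 0)"
proof -
  let ?j = "nat (nadic_index N 1 x)" and ?k = "nat (nadic_index N 1 t)"
  have b: "0 \<le> nadic_index N 1 x" "nadic_index N 1 x < int N"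
    "0 \<le> nadic_index N 1 t" "nadic_index N 1 t < int N"
    using nadic_index_bounds[OF N_pos, of _ 1] assms by auto
  have sq: "complex_of_real (sqrt (real N)) * complex_of_real (sqrt (real N)) = of_nat N"
    by (simp flip: of_real_mult)
  have "(\<Sum>i<N. walsh_filter N A i x * cnj (walsh_filter N A i t)) =
      (\<Sum>i<N. of_nat N * (A $$ (i, ?j) * cnj (A $$ (i, ?k))))"
    by (intro sum.cong refl) (simp only: walsh_filter_eq[OF N_pos assms(1)]
        walsh_filter_eq[OF N_pos assms(2)] complex_cnj_mult complex_cnj_complex_of_real
        sq[symmetric] mult_ac)
  also have "\<dots> = of_nat N * of_bool (?j = ?k)"
    using unitary_mat_columns_orthonormal[OF A_carrier A_unitary, of ?j ?k] b
    by (simp flip: sum_distrib_left)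
  finally show ?thesis using b by (auto simp: eq_nat_nat_iff)
qed

lemma num_digits_0 [simp]: "num_digits N 0 = 0"
  unfolding num_digits_def by (rule Least_eq_0) simp

lemma num_digits_append:
  assumes "N \<ge> 2" "i < N" "n * N + i \<noteq> 0"
  shows "num_digits N (n * N + i) = Suc (num_digits N n)"
proof -
  have iff: "n * N + i < N ^ Suc p \<longleftrightarrow> n < N ^ p" for p
  proof -
    have "n < N ^ p \<longleftrightarrow> (n * N + i) div N < N ^ p" using assms(1,2) by simp
    also have "\<dots> \<longleftrightarrow> n * N + i < N ^ p * N" using assms(1) by (intro div_less_iff_less_mult) simp
    finally show ?thesis by (simp add: mult.commute)
  qed
  have "n * N + i < 2 ^ (n * N + i)" by (rule less_exp)
  also have "\<dots> \<le> N ^ (n * N + i)" using assms(1) by (rule power_mono) simp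
  finally have "n * N + i < N ^ (n * N + i)" .
  then have "(LEAST p. n * N + i < N ^ p) = Suc (LEAST p. n * N + i < N ^ Suc p)"
    using assms(3) by (intro Least_Suc[of _ "n * N + i"]) auto
  then show ?thesis unfolding num_digits_def iff .
qed

text \<open>The index \<open>n * N + i\<close> has \<open>i\<close> as lowest digit and the digits of \<open>n\<close> above it. The degenerate
  case \<open>n = i = 0\<close>, where no digit is added, is consistent because the condition on the first row
  makes the filter with index \<open>0\<close> constant \<open>1\<close>.\<close>

lemma (in walsh_matrix) walsh_append_digit:
  assumes "i < N" "x \<in> {0..<1}"
  shows "walsh N A (n * N + i) x = walsh_filter N A i x * walsh N A n (frac (real N * x))"
proof (cases "n * N + i = 0")
  case True
  have "nat (nadic_index N 1 x) < N"
    using nadic_index_bounds[OF N_pos assms(2), of 1] by auto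
  then have "walsh_filter N A 0 x = 1"
    using N_pos assms by (simp add: walsh_filter_eq first_row)
  moreover have "n = 0" "i = 0" using True N_pos by auto
  ultimately show ?thesis by (simp add: walsh_def)
next
  case False
  have shift: "walsh_shift N x = frac (real N * x)" using assms(2) by (simp add: walsh_shift_def)
  have dig: "digit N (n * N + i) 0 = i" "digit N (n * N + i) (Suc k) = digit N n k" for k
    using N_pos assms(1) by (simp_all add: digit_def div_mult2_eq)
  show ?thesis
    unfolding walsh_def num_digits_append[OF N_ge_2 assms(1) False] prod.lessThan_Suc_shift dig
    by (simp add: funpow_Suc_right shift del: funpow.simps(2))
qed

lemma sum_lessThan_mult:
  fixes g :: "nat \<Rightarrow> 'a::comm_monoid_add"
  shows "(\<Sum>n<m * k. g n) = (\<Sum>n<m. \<Sum>i<k. g (n * k + i))"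
proof -
  have "sum g {n * k..<n * k + k} = (\<Sum>i<k. g (n * k + i))" for n
    using sum.shift_bounds_nat_ivl[of g 0 "n * k" k]
    by (simp add: add.commute lessThan_atLeast0)
  then show ?thesis using sum.nat_group[of g k m] by simp
qed

text \<open>Splitting off the lowest digit of \<open>n\<close> factors the double sum into the level-one kernel at
  \<open>(x, t)\<close> and the level-\<open>q\<close> kernel at the shifted points.\<close>

lemma (in walsh_matrix) walsh_kernel:
  assumes "x \<in> {0..<1}" "t \<in> {0..<1}"
  shows "(\<Sum>n<N ^ q. walsh N A n x * cnj (walsh N A n t)) =
    (if nadic_index N q x = nadic_index N q t then of_nat (N ^ q) else 0)"
  using assms
proof (induction q arbitrary: x t)
  case 0
  then have "nadic_index N 0 x = 0" "nadic_index N 0 t = 0"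
    using nadic_index_bounds[OF N_pos, of _ 0] by force+
  then show ?case by (simp add: walsh_def)
next
  case (Suc q)
  let ?x = "frac (real N * x)" and ?t = "frac (real N * t)"
  have fr: "?x \<in> {0..<1}" "?t \<in> {0..<1}" by (auto simp: frac_lt_1)
  have "(\<Sum>n<N ^ Suc q. walsh N A n x * cnj (walsh N A n t)) =
      (\<Sum>n<N ^ q. \<Sum>i<N. walsh N A (n * N + i) x * cnj (walsh N A (n * N + i) t))"
    using sum_lessThan_mult[of _ "N ^ q" N] by (simp add: mult.commute)
  also have "\<dots> = (\<Sum>n<N ^ q. \<Sum>i<N. (walsh N A n ?x * cnj (walsh N A n ?t)) *
      (walsh_filter N A i x * cnj (walsh_filter N A i t)))"
    using Suc.prems
    by (intro sum.cong refl) (simp add: walsh_append_digit mult_ac)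
  also have "\<dots> = (\<Sum>n<N ^ q. walsh N A n ?x * cnj (walsh N A n ?t)) *
      (\<Sum>i<N. walsh_filter N A i x * cnj (walsh_filter N A i t))"
    by (simp add: sum_product)
  also have "\<dots> = (if nadic_index N (Suc q) x = nadic_index N (Suc q) t
      then of_nat (N ^ Suc q) else 0)"
    unfolding Suc.IH[OF fr] sum_walsh_filter_kernel[OF Suc.prems]
      nadic_index_Suc_eq_iff[OF N_pos] by simp
  finally show ?case .
qed

section \<open>Walsh partial sums as averages over cells\<close>

lemma walsh_filter_measurable [measurable]: "walsh_filter N A i \<in> borel_measurable borel"
  unfolding walsh_filter_def[abs_def] by measurable

lemma walsh_shift_measurable [measurable]: "walsh_shift N \<in> borel_measurable borel"
  unfolding walsh_shift_def[abs_def] frac_def by measurable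

lemma walsh_measurable [measurable]: "walsh N A n \<in> borel_measurable borel"
proof -
  have [measurable]: "walsh_shift N ^^ k \<in> borel_measurable borel" for k
    by (induction k) (simp_all add: measurable_comp[OF _ walsh_shift_measurable] id_def)
  show ?thesis unfolding walsh_def[abs_def] by measurable
qed

lemma cnj_walsh_measurable [measurable]: "(\<lambda>t. cnj (walsh N A n t)) \<in> borel_measurable borel"
  by (rule measurable_compose[OF walsh_measurable])
    (intro borel_measurable_continuous_onI continuous_intros)

text \<open>Boundedness makes the Fourier coefficients of an integrable function genuine integrals, so that
  the finite sum can be moved under the integral sign.\<close>

lemma walsh_bounded: "\<exists>B. \<forall>x. norm (walsh N A n x) \<le> B"
proof -
  have "\<exists>B. \<forall>x. norm (walsh_filter N A i x) \<le> B" for i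
  proof -
    have "norm (walsh_filter N A i x) \<le> sqrt N * norm (A $$ (i, N - 1)) +
        sqrt N * (\<Sum>j<N. norm (A $$ (i, j)))" for x
    proof -
      have "norm (\<Sum>j<N. A $$ (i, j) * indicator {real j / real N ..< (real j + 1) / real N} x)
          \<le> (\<Sum>j<N. norm (A $$ (i, j)))"
        by (rule sum_norm_le) (auto simp: indicator_def)
      then show ?thesis
        by (auto simp: walsh_filter_def norm_mult sum_nonneg
            intro!: add_increasing mult_left_mono)
    qed
    then show ?thesis by blast
  qed
  then obtain B where B: "norm (walsh_filter N A i x) \<le> B i" for i x by metis
  have "norm (walsh N A n x) \<le> (\<Prod>k<num_digits N n. B (digit N n k))" for x
    unfolding walsh_def prod_norm[symmetric] by (intro prod_mono) (auto intro: B)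
  then show ?thesis by blast
qed

lemma integrable_mult_walsh:
  assumes "integrable M g" "sets M = sets borel"
  shows "integrable M (\<lambda>t. g t * cnj (walsh N A n t))"
proof -
  obtain B where B: "norm (walsh N A n x) \<le> B" for x using walsh_bounded by blast
  have [measurable]: "g \<in> borel_measurable M" using assms(1) by auto
  have [measurable]: "(\<lambda>t. cnj (walsh N A n t)) \<in> borel_measurable M"
    by (simp add: measurable_cong_sets[OF assms(2) refl])
  show ?thesis
  proof (rule Bochner_Integration.integrable_bound)
    show "integrable M (\<lambda>t. B *\<^sub>R g t)" using assms(1) by simp
    have "norm (g t * cnj (walsh N A n t)) \<le> norm (B *\<^sub>R g t)" for t
    proof -
      have "norm (g t) * norm (walsh N A n t) \<le> norm (g t) * \<bar>B\<bar>"
        using B[of t] by (intro mult_left_mono) auto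
      then show ?thesis by (simp add: norm_mult mult.commute)
    qed
    then show "AE t in M. norm (g t * cnj (walsh N A n t)) \<le> norm (B *\<^sub>R g t)" by simp
  qed measurable
qed

lemma LINT_unit_space:
  assumes "S \<in> sets borel" "S \<subseteq> {0..<1}"
  shows "(LINT x:S|unit_space. (g x :: complex)) = (LINT x:S|lborel. g x)"
proof -
  have "indicat_real {0..<1} x *\<^sub>R (indicat_real S x *\<^sub>R g x) = indicat_real S x *\<^sub>R g x" for x
    using assms(2) by (auto simp: indicator_def)
  moreover have "{0..<1::real} \<inter> space lborel \<in> sets lborel" by simp
  ultimately show ?thesis
    unfolding set_lebesgue_integral_def unit_space_def
    by (simp only: integral_restrict_space)
qed

lemma integrable_unit_space_iff:
  "integrable unit_space (f :: real \<Rightarrow> complex) \<longleftrightarrow> set_integrable lborel {0..<1} f"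
  unfolding unit_space_def set_integrable_def by (rule integrable_restrict_space) simp

text \<open>The sum is the integral of \<open>f\<close> against the kernel, which as a function of \<open>t\<close> is \<open>N ^ q\<close>
  times the indicator of the cell containing \<open>x\<close>; the factor \<open>N ^ q\<close> is the reciprocal of the
  length of that cell.\<close>

lemma (in walsh_matrix) walsh_sum_eq_cell_average:
  assumes f: "set_integrable lborel {0..1} f"
    and j: "j < N ^ q" and x: "x \<in> nadic_cell N q j"
  shows "walsh_sum N A f (N ^ q) x = of_nat (N ^ q) * (LINT t:nadic_cell N q j|lborel. f t)"
proof -
  have x01: "x \<in> {0..<1}" using x nadic_cell_subset[OF N_pos j] by blast
  let ?f = "\<lambda>t. indicat_real {0..1} t *\<^sub>R f t"
  have f_int: "integrable lborel ?f" using f by (simp add: set_integrable_def)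
  have int: "integrable lborel (\<lambda>t. ?f t * cnj (walsh N A n t))" for n
    by (rule integrable_mult_walsh[OF f_int]) simp
  have "walsh_sum N A f (N ^ q) x =
      (\<Sum>n<N ^ q. (LINT t|lborel. ?f t * cnj (walsh N A n t)) * walsh N A n x)"
    by (simp add: walsh_sum_def unit_inner_def set_lebesgue_integral_def)
  also have "\<dots> = (\<Sum>n<N ^ q. LINT t|lborel. ?f t * cnj (walsh N A n t) * walsh N A n x)"
    by (simp only: integral_mult_left_zero)
  also have "\<dots> = (LINT t|lborel. (\<Sum>n<N ^ q. ?f t * cnj (walsh N A n t) * walsh N A n x))"
    by (rule Bochner_Integration.integral_sum[symmetric]) (intro integrable_mult_left int)
  also have "\<dots> = (LINT t|lborel. of_nat (N ^ q) * (indicat_real (nadic_cell N q j) t *\<^sub>R f t))"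
  proof (rule integral_cong_AE)
    have [measurable]: "?f \<in> borel_measurable lborel" using f_int by auto
    show "(\<lambda>t. \<Sum>n<N ^ q. ?f t * cnj (walsh N A n t) * walsh N A n x) \<in> borel_measurable lborel"
      by measurable
    have restrict: "indicat_real (nadic_cell N q j) t *\<^sub>R f t =
        indicat_real (nadic_cell N q j) t *\<^sub>R ?f t"
      for t using nadic_cell_subset[OF N_pos j] by (auto simp: indicator_def)
    have [measurable]: "nadic_cell N q j \<in> sets borel" by (simp add: nadic_cell_def)
    show "(\<lambda>t. of_nat (N ^ q) * (indicat_real (nadic_cell N q j) t *\<^sub>R f t))
        \<in> borel_measurable lborel" unfolding restrict by measurable
    \<comment> \<open>The endpoint \<open>1\<close> belongs to the domain of the inner product but to no cell; it is a null set.\<close>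
    have "AE t in lborel. t \<noteq> (1::real)" by (rule AE_lborel_singleton)
    then show "AE t in lborel. (\<Sum>n<N ^ q. ?f t * cnj (walsh N A n t) * walsh N A n x) =
        of_nat (N ^ q) * (indicat_real (nadic_cell N q j) t *\<^sub>R f t)"
    proof eventually_elim
      case (elim t)
      show ?case
      proof (cases "t \<in> {0..<1}")
        case True
        have "(\<Sum>n<N ^ q. ?f t * cnj (walsh N A n t) * walsh N A n x) =
            f t * (\<Sum>n<N ^ q. walsh N A n x * cnj (walsh N A n t))"
          using True by (simp add: sum_distrib_left mult_ac)
        then show ?thesis
          using x unfolding walsh_kernel[OF x01 True] mem_nadic_cell_iff[OF N_pos]
          by (auto simp: indicator_def mem_nadic_cell_iff[OF N_pos])
      next
        case False
        then have "t \<notin> {0..1}" "t \<notin> nadic_cell N q j"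
          using elim nadic_cell_subset[OF N_pos j] by auto
        then show ?thesis by simp
      qed
    qed
  qed
  also have "\<dots> = of_nat (N ^ q) * (LINT t:nadic_cell N q j|lborel. f t)"
    unfolding set_lebesgue_integral_def by (rule integral_mult_right_zero)
  finally show ?thesis .
qed

lemma walsh_sum_integrable: "integrable unit_space (walsh_sum N A f K)"
proof -
  obtain B where B: "norm (walsh N A n x) \<le> B n" for n x using walsh_bounded by metis
  have "norm (walsh_sum N A f K x) \<le> (\<Sum>n<K. norm (unit_inner f (walsh N A n)) * B n)" for x
    unfolding walsh_sum_def by (rule sum_norm_le) (auto simp: norm_mult intro: mult_left_mono B)
  moreover have "walsh_sum N A f K \<in> borel_measurable unit_space"
    unfolding unit_space_def walsh_sum_def[abs_def]
    by (intro measurable_restrict_space1) measurable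
  ultimately show ?thesis
    by (intro finite_measure.integrable_const_bound[OF finite_measure_unit_space]) auto
qed

lemma (in walsh_matrix) walsh_sum_nadic_measurable:
  assumes f: "set_integrable lborel {0..1} f"
  shows "walsh_sum N A f (N ^ q) \<in> borel_measurable (nadic_algebra N q)"
proof -
  let ?g = "\<lambda>i. of_nat (N ^ q) * (LINT t:nadic_cell N q (nat i)|lborel. f t)"
  have "walsh_sum N A f (N ^ q) x = ?g (nadic_index N q x)"
    if "x \<in> space (nadic_algebra N q)" for x
  proof -
    have "x \<in> {0..<1}" using that by simp
    then obtain j where "j < N ^ q" "x \<in> nadic_cell N q j"
      unfolding UN_nadic_cells[OF N_pos, of q, symmetric] by blast
    then show ?thesis
      using walsh_sum_eq_cell_average[OF f, of j q x] mem_nadic_cell_iff[OF N_pos, of x q j] by simp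
  qed
  then show ?thesis
    using measurable_nadic_algebraI[OF N_pos, of ?g q] by (subst measurable_cong) auto
qed

text \<open>Replacing a function on a cell by its average there preserves the integral over the cell, hence
  over every finite union of cells.\<close>

lemma (in walsh_matrix) cond_exp_eq_walsh_sum:
  assumes f: "set_integrable lborel {0..1} f"
  shows "AE x in unit_space.
    complex_cond_exp unit_space (nadic_algebra N q) f x = walsh_sum N A f (N ^ q) x"
proof -
  interpret sigma_finite_subalgebra unit_space "nadic_algebra N q"
    by (rule sigma_finite_subalgebra_nadic[OF N_pos])
  let ?S = "walsh_sum N A f (N ^ q)"
  have f_int: "integrable unit_space f"
    unfolding integrable_unit_space_iff by (rule set_integrable_subset[OF f]) auto
  have cells: "(LINT x:nadic_cell N q j|unit_space. f x) = (LINT x:nadic_cell N q j|unit_space. ?S x)"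
    if j: "j < N ^ q" for j
  proof -
    let ?c = "nadic_cell N q j"
    have c: "?c \<in> sets borel" "?c \<subseteq> {0..<1}"
      using nadic_cell_subset[OF N_pos j] by (auto simp: nadic_cell_def)
    have "(LINT x:?c|lborel. ?S x) =
        (LINT x:?c|lborel. of_nat (N ^ q) * (LINT t:?c|lborel. f t))"
      using c(1) by (intro set_lebesgue_integral_cong) (auto simp: walsh_sum_eq_cell_average[OF f j])
    also have "\<dots> = measure lborel ?c *\<^sub>R (of_nat (N ^ q) * (LINT t:?c|lborel. f t))"
    proof -
      have "emeasure lborel ?c < \<infinity>"
        by (rule emeasure_bounded_finite) (simp add: nadic_cell_def)
      with c(1) show ?thesis
        unfolding set_lebesgue_integral_def[of _ _ "\<lambda>x. of_nat (N ^ q) * _"]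
        by (intro has_bochner_integral_integral_eq has_bochner_integral_indicator) simp_all
    qed
    also have "measure lborel ?c = 1 / real (N ^ q)"
    proof -
      have "(real j + 1) / real (N ^ q) - real j / real (N ^ q) = 1 / real (N ^ q)"
        by (simp flip: diff_divide_distrib)
      moreover have "real j / real (N ^ q) \<le> (real j + 1) / real (N ^ q)"
        by (intro divide_right_mono) auto
      ultimately show ?thesis
        unfolding nadic_cell_def by simp
    qed
    also have "(1 / real (N ^ q)) *\<^sub>R (of_nat (N ^ q) * (LINT t:?c|lborel. f t)) =
        (LINT t:?c|lborel. f t)"
      using N_pos by (simp add: scaleR_conv_of_real)
    finally show ?thesis using LINT_unit_space[OF c] by simp
  qed
  show ?thesis
  proof (rule complex_cond_exp_charact[OF _ f_int walsh_sum_integrable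
        walsh_sum_nadic_measurable[OF f]])
    fix S assume "S \<in> sets (nadic_algebra N q)"
    then obtain J where J: "J \<subseteq> {..<N ^ q}" "S = (\<Union>j\<in>J. nadic_cell N q j)"
      unfolding sets_nadic_algebra_iff[OF N_pos] by blast
    have fin: "finite J" using J(1) by (rule finite_subset) simp
    have meas: "nadic_cell N q j \<in> sets unit_space" if "j \<in> J" for j
      using that J(1) nadic_cell_subset[OF N_pos] unfolding sets_unit_space
      by (auto simp: nadic_cell_def)
    have disj: "disjoint_family_on (nadic_cell N q) J"
      unfolding disjoint_family_on_def using mem_nadic_cell_iff[OF N_pos] by auto
    have split: "(LINT x:S|unit_space. h x) = (\<Sum>j\<in>J. LINT x:nadic_cell N q j|unit_space. h x)"
      if h: "integrable unit_space h" for h :: "real \<Rightarrow> complex"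
      unfolding J(2)
      by (rule set_integral_finite_Union[OF fin disj])
        (auto simp: set_integrable_def intro!: integrable_mult_indicator meas h)
    show "(LINT x:S|unit_space. f x) = (LINT x:S|unit_space. ?S x)"
      unfolding split[OF f_int] split[OF walsh_sum_integrable]
      using J(1) by (intro sum.cong refl cells) auto
  qed
qed

theorem theorem2p6:
  fixes N :: nat and A :: "complex mat" and f :: "real \<Rightarrow> complex"
  assumes "N \<ge> 2"
    and "A \<in> carrier_mat N N"
    and "unitary_mat A"
    and "\<And>j. j < N \<Longrightarrow> A $$ (0, j) = 1 / complex_of_real (sqrt (real N))"
    and "set_integrable lborel {0..1} f"
  shows "complex_martingale_on {1..} unit_space (nadic_algebra N) (\<lambda>q. walsh_sum N A f (N ^ q)) \<and>
    (\<forall>q\<ge>1.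
      (AE x in unit_space.
         complex_cond_exp unit_space (nadic_algebra N q) f x = walsh_sum N A f (N ^ q) x) \<and>
      (AE x in unit_space.
         complex_cond_exp unit_space (nadic_algebra N q) (walsh_sum N A f (N ^ (q + 1))) x
           = walsh_sum N A f (N ^ q) x))"
proof -
  interpret walsh_matrix N A
    using assms(1-4) by unfold_locales
  have f_int: "integrable unit_space f"
    unfolding integrable_unit_space_iff by (rule set_integrable_subset[OF assms(5)]) auto
  have tower: "AE x in unit_space.
      complex_cond_exp unit_space (nadic_algebra N p) (walsh_sum N A f (N ^ q)) x
        = walsh_sum N A f (N ^ p) x" if "p \<le> q" for p q
  proof -
    interpret sigma_finite_subalgebra unit_space "nadic_algebra N p"
      by (rule sigma_finite_subalgebra_nadic[OF N_pos])
    show ?thesis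
      using complex_cond_exp_of_cond_exp[OF subalgebra_unit_space[OF N_pos]
          subalgebra_nadic_algebra_mono[OF N_pos that] f_int walsh_sum_integrable
          cond_exp_eq_walsh_sum[OF assms(5)]]
        cond_exp_eq_walsh_sum[OF assms(5), of p]
      by eventually_elim simp
  qed
  have "complex_martingale_on {1..} unit_space (nadic_algebra N) (\<lambda>q. walsh_sum N A f (N ^ q))"
    unfolding complex_martingale_on_def
    by (intro conjI ballI impI subalgebra_unit_space[OF N_pos] subalgebra_nadic_algebra_mono[OF N_pos]
        walsh_sum_nadic_measurable[OF assms(5)] walsh_sum_integrable tower)
  then show ?thesis
    by (intro conjI allI impI cond_exp_eq_walsh_sum[OF assms(5)] tower) simp_all
qed

end
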